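(* Let $d\ge2$ be an integer. For every integer $\ell\ge1$, the defect $D_\ell$ of the random hyperspherical harmonic $T_\ell$ on $\mathbb S^d$ satisfies $\mathbb E[D_\ell]=0$.
   Context: Let $\mathbb S^d\subset\mathbb R^{d+1}$ be the unit sphere with its Lebesgue (surface) measure $dx$, total mass $|\mathbb S^d|$, and geodesic distance $d(x,y)$. For an integer $\ell\ge1$, the eigenspace of the Laplace–Beltrami operator for the eigenvalue $-\ell(\ell+d-1)$ has dimension $n_{\ell;d}=\frac{2\ell+d-1}{\ell}\binom{\ell+d-2}{\ell-1}$ and real orthonormal basis (in $L^2(\mathbb S^d)$) $(Y_{\ell,m;d})_{m=1}^{n_{\ell;d}}$ (hyperspherical harmonics). The random hyperspherical harmonic is $T_\ell(x)=\sum_{m=1}^{n_{\ell;d}}a_{\ell,m;d}Y_{\ell,m;d}(x)$, where the $a_{\ell,m;d}$ are i.i.d. centered real Gaussian with variance $|\mathbb S^d|/n_{\ell;d}$. Equivalently $T_\ell$ is the centered Gaussian field on $\mathbb S^d$ with covariance $\operatorname{Cov}(T_\ell(x),T_\ell(y))=G_{\ell;d}(\cos d(x,y))$, where $G_{\ell;d}=\binom{\ell+d/2-1}{\ell}^{-1}P_\ell^{(d/2-1,d/2-1)}$ is the Gegenbauer polynomial normalized by $G_{\ell;d}(1)=1$ ($P_\ell^{(a,b)}$ the Jacobi polynomials). The defect is $D_\ell=\int_{\mathbb S^d}\mathcal H(T_\ell(x))\,dx$, with $\mathcal H(t)=1_{(0,+\infty)}(t)-1_{(-\infty,0)}(t)$.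 *)

theory Defs
  imports "HOL-Probability.Probability"
begin

text \<open>
  \<open>S\<^sup>d\<close> is \<open>sphere 0 1\<close> in a Euclidean space of dimension \<open>d + 1\<close>. A function on the sphere is
  represented by a function on the ambient space whose values off the sphere are irrelevant.
\<close>

section \<open>Surface measure\<close>

text \<open>
  The surface measure of \<open>A\<close> is \<open>d + 1\<close> times the Lebesgue measure of the cone
  \<open>{r x | 0 < r < 1, x \<in> A}\<close> (integration in polar coordinates, \<open>\<integral>\<^sub>0\<^sup>1 r\<^sup>d dr = 1 / (d + 1)\<close>).
\<close>
definition sphere_measure :: "'a::euclidean_space measure" where
  "sphere_measure =
     scale_measure (of_nat DIM('a))
       (distr (restrict_space lborel (ball 0 1 - {0})) (restrict_space borel (sphere 0 1))
          (\<lambda>x. x /\<^sub>R norm x))"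

lemma space_sphere_measure [simp]: "space sphere_measure = sphere 0 1"
  by (simp add: sphere_measure_def space_scale_measure space_restrict_space)

lemma sets_sphere_measure [simp, measurable_cong]:
  "sets sphere_measure = sets (restrict_space borel (sphere 0 1))"
  by (simp add: sphere_measure_def)

lemma emeasure_sphere_measure:
  fixes A :: "'a::euclidean_space set"
  assumes "A \<in> sets borel" "A \<subseteq> sphere 0 1"
  shows "emeasure sphere_measure A =
           of_nat DIM('a) * emeasure lborel {x \<in> ball 0 1 - {0}. x /\<^sub>R norm x \<in> A}"
proof -
  have m: "(\<lambda>x. x /\<^sub>R norm x) \<in>
      restrict_space lborel (ball 0 1 - {0}) \<rightarrow>\<^sub>M restrict_space borel (sphere (0::'a) 1)"
    by (intro measurable_restrict_space3) (auto simp: measurable_lborel1)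
  have A: "A \<in> sets (restrict_space borel (sphere 0 1))"
    using assms by (auto simp: sets_restrict_space)
  have eq: "(\<lambda>x. x /\<^sub>R norm x) -` A \<inter> (ball 0 1 - {0}) = {x \<in> ball 0 1 - {0}. x /\<^sub>R norm x \<in> A}"
    by blast
  show ?thesis
    unfolding sphere_measure_def emeasure_scale_measure emeasure_distr[OF m A]
    by (subst emeasure_restrict_space) (auto simp: space_restrict_space eq)
qed

section \<open>Spherical harmonics\<close>

text \<open>For open \<open>S\<close>: \<open>f\<close> is \<open>k\<close> times continuously differentiable on \<open>S\<close>.\<close>
primrec Ck_on :: "nat \<Rightarrow> 'a::euclidean_space set \<Rightarrow> ('a \<Rightarrow> real) \<Rightarrow> bool" where
  "Ck_on 0 S f \<longleftrightarrow> continuous_on S f"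
| "Ck_on (Suc k) S f \<longleftrightarrow>
     f differentiable_on S \<and> (\<forall>v. Ck_on k S (\<lambda>x. frechet_derivative f (at x) v))"

definition homogeneous_ext :: "('a::euclidean_space \<Rightarrow> real) \<Rightarrow> 'a \<Rightarrow> real" where
  "homogeneous_ext f x = f (x /\<^sub>R norm x)"

text \<open>
  Smoothness on the sphere is smoothness of the degree-0 homogeneous extension on the punctured
  space, since \<open>x \<mapsto> x / norm x\<close> is a smooth retraction onto the sphere.
\<close>
definition smooth_on_sphere :: "('a::euclidean_space \<Rightarrow> real) \<Rightarrow> bool" where
  "smooth_on_sphere f \<longleftrightarrow> (\<forall>k. Ck_on k (- {0}) (homogeneous_ext f))"

definition laplacian :: "('a::euclidean_space \<Rightarrow> real) \<Rightarrow> 'a \<Rightarrow> real" where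
  "laplacian F x = (\<Sum>b\<in>Basis. (deriv ^^ 2) (\<lambda>t. F (x + t *\<^sub>R b)) 0)"

text \<open>
  The Laplace--Beltrami operator of the round sphere: the Euclidean Laplacian of the degree-0
  homogeneous extension. The radial part of the Euclidean Laplacian vanishes on such an extension,
  and the rest is the Laplacian of the induced metric at points of the sphere.
\<close>
definition laplace_beltrami :: "('a::euclidean_space \<Rightarrow> real) \<Rightarrow> 'a \<Rightarrow> real" where
  "laplace_beltrami f x = laplacian (homogeneous_ext f) x"

definition lb_eigenspace :: "real \<Rightarrow> ('a::euclidean_space \<Rightarrow> real) set" where
  "lb_eigenspace c =
     {f. smooth_on_sphere f \<and> (\<forall>x\<in>sphere 0 1. laplace_beltrami f x = c * f x)}"

text \<open>\<open>Y\<close>, indexed by the finite set \<open>I\<close>, is an \<open>L\<^sup>2\<close>-orthonormal basis of the function space \<open>V\<close>;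
  elements of \<open>V\<close> are identified when they agree on the sphere.\<close>
definition orthonormal_basis_on_sphere ::
    "('a::euclidean_space \<Rightarrow> real) set \<Rightarrow> 'i set \<Rightarrow> ('i \<Rightarrow> 'a \<Rightarrow> real) \<Rightarrow> bool" where
  "orthonormal_basis_on_sphere V I Y \<longleftrightarrow>
     finite I \<and> (\<forall>m\<in>I. Y m \<in> V) \<and>
     (\<forall>m\<in>I. \<forall>k\<in>I. (\<integral>x. Y m x * Y k x \<partial>sphere_measure) = (if m = k then 1 else 0)) \<and>
     (\<forall>f\<in>V. \<exists>c. \<forall>x\<in>sphere 0 1. f x = (\<Sum>m\<in>I. c m * Y m x))"

text \<open>The dimension \<open>n\<^sub>\<ell>\<^sub>;\<^sub>d\<close>; the division is exact.\<close>
definition harmonic_dim :: "nat \<Rightarrow> nat \<Rightarrow> nat" where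
  "harmonic_dim l d = (2 * l + d - 1) * ((l + d - 2) choose (l - 1)) div l"

lemma real_harmonic_dim:
  assumes "l \<ge> 1" "d \<ge> 2"
  shows "real (harmonic_dim l d) =
           (2 * real l + real d - 1) / real l * real ((l + d - 2) choose (l - 1))"
proof -
  define k e where "k = l - 1" and "e = d - 2"
  then have l: "l = Suc k" and d: "d = Suc (Suc e)"
    using assms by auto
  have "(2 * l + d - 1) * ((l + d - 2) choose (l - 1))
      = l * ((l + d - 2) choose (l - 1)) + Suc (k + e + 1) * ((k + e + 1) choose k)"
    by (simp add: l d algebra_simps)
  also have "Suc (k + e + 1) * ((k + e + 1) choose k) = l * (Suc (k + e + 1) choose Suc k)"
    by (simp only: l Suc_times_binomial_eq mult.commute)
  finally have "l dvd (2 * l + d - 1) * ((l + d - 2) choose (l - 1))"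
    by simp
  then show ?thesis
    using assms by (simp add: harmonic_dim_def real_of_nat_div of_nat_diff)
qed

section \<open>The random field and its defect\<close>

definition random_harmonic ::
    "'i set \<Rightarrow> ('i \<Rightarrow> 'a \<Rightarrow> real) \<Rightarrow> ('i \<Rightarrow> 'w \<Rightarrow> real) \<Rightarrow> 'w \<Rightarrow> 'a::euclidean_space \<Rightarrow> real" where
  "random_harmonic I Y a \<omega> x = (\<Sum>m\<in>I. a m \<omega> * Y m x)"

definition heaviside_sym :: "real \<Rightarrow> real" where
  "heaviside_sym t = indicator {0<..} t - indicator {..<0} t"

definition defect :: "('a::euclidean_space \<Rightarrow> real) \<Rightarrow> real" where
  "defect T = (\<integral>x. heaviside_sym (T x) \<partial>sphere_measure)"

end

theory Submission imports Defs begin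

text \<open>
  The coefficient vector \<open>a\<close> of the random harmonic has a product law with symmetric marginals,
  so \<open>a\<close> and \<open>- a\<close> have the same law. The field depends linearly on \<open>a\<close> and the function
  \<open>heaviside_sym\<close> is odd, so the defect is an odd function of \<open>a\<close>: replacing \<open>a\<close> by \<open>- a\<close> preserves
  its expectation and also flips its sign, hence the expectation vanishes
  (\<open>expectation_odd_function_symmetric_indep\<close>).

  The analytic content is that this expectation is a genuine one. The sphere has finite surface
  measure, which bounds the defect uniformly, and harmonics are continuous on the sphere, which makes
  the field jointly measurable in the coefficients and the point, so that the integral over the
  sphere is measurable in the coefficients.
\<close>

lemma distributed_even_density_symmetric:
  fixes X :: "'w \<Rightarrow> real" and g :: "real \<Rightarrow> real"
  assumes X: "distributed M lborel X g" and even: "\<And>x. g (- x) = g x"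
  shows "distr M borel (\<lambda>\<omega>. - X \<omega>) = distr M borel X"
proof -
  have [measurable]: "X \<in> borel_measurable M" "(\<lambda>x. ennreal (g x)) \<in> borel_measurable borel"
    using X by (auto simp: distributed_def)
  have law: "distr M borel X = density lborel (\<lambda>x. ennreal (g x))"
    using distributed_distr_eq_density[OF X] by (simp cong: distr_cong)
  have "distr M borel (\<lambda>\<omega>. - X \<omega>) = distr (distr M borel X) borel uminus"
    by (subst distr_distr) (auto simp: comp_def)
  also have "\<dots> = distr (density lborel (\<lambda>x. ennreal (g (- x)))) borel uminus"
    by (simp add: law even)
  also have "\<dots> = density (distr lborel borel uminus) (\<lambda>x. ennreal (g x))"
    by (rule density_distr[symmetric]) auto
  also have "\<dots> = distr M borel X"
    by (simp add: law lborel_distr_uminus)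
  finally show ?thesis .
qed

lemma (in prob_space) indep_symmetric_joint_law:
  fixes X :: "'i \<Rightarrow> 'a \<Rightarrow> real"
  assumes ind: "indep_vars (\<lambda>_. borel) X I"
    and symm: "\<And>i. i \<in> I \<Longrightarrow> distr M borel (\<lambda>\<omega>. - X i \<omega>) = distr M borel (X i)"
  shows "distr M (PiM I (\<lambda>_. borel)) (\<lambda>\<omega>. \<lambda>i\<in>I. - X i \<omega>) =
         distr M (PiM I (\<lambda>_. borel)) (\<lambda>\<omega>. \<lambda>i\<in>I. X i \<omega>)"
proof (cases "I = {}")
  case False
  have rv: "\<And>i. i \<in> I \<Longrightarrow> X i \<in> borel_measurable M"
    using ind by (auto simp: indep_vars_def)
  have ind': "indep_vars (\<lambda>_. borel) (\<lambda>i \<omega>. - X i \<omega>) I"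
    by (rule indep_vars_compose2[OF ind]) auto
  have "distr M (PiM I (\<lambda>_. borel)) (\<lambda>\<omega>. \<lambda>i\<in>I. - X i \<omega>) =
        PiM I (\<lambda>i. distr M borel (\<lambda>\<omega>. - X i \<omega>))"
    using indep_vars_iff_distr_eq_PiM'[OF False, of "\<lambda>i \<omega>. - X i \<omega>" "\<lambda>_. borel"] ind' rv by auto
  also have "\<dots> = PiM I (\<lambda>i. distr M borel (X i))"
    by (rule PiM_cong) (auto simp: symm)
  also have "\<dots> = distr M (PiM I (\<lambda>_. borel)) (\<lambda>\<omega>. \<lambda>i\<in>I. X i \<omega>)"
    using indep_vars_iff_distr_eq_PiM'[OF False, of X "\<lambda>_. borel"] ind rv by auto
  finally show ?thesis .
qed (simp add: restrict_def)

text \<open>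
  The two ways of evaluating \<open>E[F(- X)]\<close>, by oddness of \<open>F\<close> and by symmetry of the law of \<open>X\<close>, give
  opposite values. If \<open>F(X)\<close> fails to be integrable, both are \<open>0\<close> by convention.
\<close>
lemma (in prob_space) expectation_odd_function_symmetric_indep:
  fixes X :: "'i \<Rightarrow> 'a \<Rightarrow> real" and F :: "('i \<Rightarrow> real) \<Rightarrow> real"
  assumes ind: "indep_vars (\<lambda>_. borel) X I"
    and symm: "\<And>i. i \<in> I \<Longrightarrow> distr M borel (\<lambda>\<omega>. - X i \<omega>) = distr M borel (X i)"
    and F: "F \<in> borel_measurable (PiM I (\<lambda>_. borel))"
    and odd: "\<And>x. F (\<lambda>i\<in>I. - x i) = - F (\<lambda>i\<in>I. x i)"
  shows "expectation (\<lambda>\<omega>. F (\<lambda>i\<in>I. X i \<omega>)) = 0"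
proof -
  have rv: "\<And>i. i \<in> I \<Longrightarrow> X i \<in> borel_measurable M"
    using ind by (auto simp: indep_vars_def)
  have m: "(\<lambda>\<omega>. \<lambda>i\<in>I. X i \<omega>) \<in> M \<rightarrow>\<^sub>M PiM I (\<lambda>_. borel)"
    by (rule measurable_restrict) (rule rv)
  have m': "(\<lambda>\<omega>. \<lambda>i\<in>I. - X i \<omega>) \<in> M \<rightarrow>\<^sub>M PiM I (\<lambda>_. borel)"
    by (rule measurable_restrict) (auto intro: rv)
  have "expectation (\<lambda>\<omega>. F (\<lambda>i\<in>I. - X i \<omega>)) = expectation (\<lambda>\<omega>. F (\<lambda>i\<in>I. X i \<omega>))"
    using integral_distr[OF m F] integral_distr[OF m' F] indep_symmetric_joint_law[OF ind symm]
    by simp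
  then show ?thesis
    by (simp add: odd)
qed

lemma finite_measure_sphere_measure:
  "finite_measure (sphere_measure :: 'a::euclidean_space measure)"
proof
  have "emeasure lborel {x \<in> ball (0::'a) 1 - {0}. x /\<^sub>R norm x \<in> sphere 0 1}
      \<le> emeasure lborel (ball (0::'a) 1)"
    by (rule emeasure_mono) auto
  also have "\<dots> < \<infinity>"
    using emeasure_bounded_finite[of "ball (0::'a) 1"] by simp
  finally show "emeasure sphere_measure (space (sphere_measure :: 'a measure)) \<noteq> \<infinity>"
    by (simp add: emeasure_sphere_measure ennreal_mult_eq_top_iff)
qed

lemma abs_heaviside_sym_le_1: "\<bar>heaviside_sym t\<bar> \<le> 1"
  by (simp add: heaviside_sym_def indicator_def)

lemma heaviside_sym_uminus: "heaviside_sym (- t) = - heaviside_sym t"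
  by (simp add: heaviside_sym_def indicator_def)

lemma borel_measurable_heaviside_sym [measurable]: "heaviside_sym \<in> borel_measurable borel"
  unfolding heaviside_sym_def[abs_def] by measurable

lemma defect_uminus: "defect (\<lambda>x. - T x) = - defect T"
  by (simp add: defect_def heaviside_sym_uminus)

lemma abs_defect_le:
  fixes T :: "'a::euclidean_space \<Rightarrow> real"
  shows "\<bar>defect T\<bar> \<le> measure (sphere_measure :: 'a measure) (sphere 0 1)"
proof -
  interpret S: finite_measure "sphere_measure :: 'a measure"
    by (rule finite_measure_sphere_measure)
  show ?thesis
  proof (cases "integrable sphere_measure (\<lambda>x. heaviside_sym (T x))")
    case True
    have "\<bar>defect T\<bar> \<le> (\<integral>x. \<bar>heaviside_sym (T x)\<bar> \<partial>sphere_measure)"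
      unfolding defect_def by (rule integral_abs_bound)
    also have "\<dots> \<le> (\<integral>x. 1 \<partial>(sphere_measure :: 'a measure))"
      using True by (intro integral_mono) (auto simp: abs_heaviside_sym_le_1)
    finally show ?thesis
      by simp
  qed (simp add: defect_def not_integrable_integral_eq)
qed

text \<open>
  On the sphere a function coincides with its degree-0 homogeneous extension, so the case \<open>k = 0\<close>
  of the \<open>C\<^sup>k\<close> conditions on the extension already gives continuity there.
\<close>
lemma smooth_on_sphere_measurable:
  assumes "smooth_on_sphere f"
  shows "f \<in> borel_measurable sphere_measure"
proof -
  have "continuous_on (- {0}) (homogeneous_ext f)"
    using assms unfolding smooth_on_sphere_def by (metis Ck_on.simps(1))
  then have "continuous_on (sphere 0 1) (homogeneous_ext f)"
    by (rule continuous_on_subset) auto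
  then have "continuous_on (sphere 0 1) f"
    by (rule continuous_on_eq) (simp add: homogeneous_ext_def)
  then have "f \<in> borel_measurable (restrict_space borel (sphere 0 1))"
    by (rule borel_measurable_continuous_on_restrict)
  then show ?thesis
    by (simp cong: measurable_cong_sets)
qed

text \<open>
  The coefficients are the elementary outcome here: for \<open>a = (\<lambda>m x. x m)\<close> the random harmonic is a
  deterministic function of the vector \<open>x\<close>.
\<close>
lemma defect_linear_combination_measurable:
  fixes Y :: "'i \<Rightarrow> 'a::euclidean_space \<Rightarrow> real"
  assumes Y: "\<And>m. m \<in> I \<Longrightarrow> Y m \<in> borel_measurable sphere_measure"
  shows "(\<lambda>x. defect (random_harmonic I Y (\<lambda>m x. x m) x)) \<in> borel_measurable (PiM I (\<lambda>_. borel))"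
proof -
  interpret S: finite_measure "sphere_measure :: 'a measure"
    by (rule finite_measure_sphere_measure)
  let ?P = "PiM I (\<lambda>_. borel) \<Otimes>\<^sub>M (sphere_measure :: 'a measure)"
  have "(\<lambda>z. fst z m * Y m (snd z)) \<in> borel_measurable ?P" if m: "m \<in> I" for m
  proof (rule borel_measurable_times)
    show "(\<lambda>z. fst z m) \<in> borel_measurable ?P"
      by (rule measurable_compose[OF measurable_fst measurable_component_singleton[OF m]])
    show "(\<lambda>z. Y m (snd z)) \<in> borel_measurable ?P"
      by (rule measurable_compose[OF measurable_snd Y[OF m]])
  qed
  then have "(\<lambda>z. \<Sum>m\<in>I. fst z m * Y m (snd z)) \<in> borel_measurable ?P"
    by (rule borel_measurable_sum)
  from measurable_compose[OF this borel_measurable_heaviside_sym]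
  have "(\<lambda>(x, p). heaviside_sym (\<Sum>m\<in>I. x m * Y m p)) \<in> borel_measurable ?P"
    by (simp add: split_beta')
  then show ?thesis
    unfolding defect_def random_harmonic_def
    by (rule S.borel_measurable_lebesgue_integral)
qed

theorem lemma1p1:
  fixes d l :: nat
    and Y :: "nat \<Rightarrow> real ^ 'n \<Rightarrow> real"
    and M :: "'w measure"
    and a :: "nat \<Rightarrow> 'w \<Rightarrow> real"
  assumes "d \<ge> 2" and "CARD('n) = d + 1" and "l \<ge> 1"
    and "orthonormal_basis_on_sphere (lb_eigenspace (- (real l * (real l + real d - 1))))
           {1..harmonic_dim l d} Y"
    and "prob_space M"
    and "prob_space.indep_vars M (\<lambda>_. borel) a {1..harmonic_dim l d}"
    and "\<And>m. m \<in> {1..harmonic_dim l d} \<Longrightarrow>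
           distributed M lborel (a m)
             (normal_density 0
               (sqrt (measure sphere_measure (sphere (0 :: real ^ 'n) 1) / real (harmonic_dim l d))))"
  shows "integrable M (\<lambda>\<omega>. defect (random_harmonic {1..harmonic_dim l d} Y a \<omega>)) \<and>
         (\<integral>\<omega>. defect (random_harmonic {1..harmonic_dim l d} Y a \<omega>) \<partial>M) = 0"
proof -
  interpret prob_space M by fact
  define I where "I = {1..harmonic_dim l d}"
  define F where "F = (\<lambda>x. defect (random_harmonic I Y (\<lambda>m x. x m) x))"
  have ind: "indep_vars (\<lambda>_. borel) a I"
    using assms(6) by (simp add: I_def)
  have symm: "distr M borel (\<lambda>\<omega>. - a m \<omega>) = distr M borel (a m)" if "m \<in> I" for m
    by (rule distributed_even_density_symmetric[OF assms(7)])
      (use that in \<open>auto simp: I_def normal_density_def\<close>)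
  have F: "F \<in> borel_measurable (PiM I (\<lambda>_. borel))"
    unfolding F_def
    using assms(4)
    by (intro defect_linear_combination_measurable smooth_on_sphere_measurable)
      (auto simp: I_def orthonormal_basis_on_sphere_def lb_eigenspace_def)
  have odd: "F (\<lambda>i\<in>I. - x i) = - F (\<lambda>i\<in>I. x i)" for x
    by (simp add: F_def random_harmonic_def[abs_def] sum_negf defect_uminus)
  have field: "defect (random_harmonic I Y a \<omega>) = F (\<lambda>i\<in>I. a i \<omega>)" for \<omega>
    by (simp add: F_def random_harmonic_def[abs_def])
  have rv: "(\<lambda>\<omega>. \<lambda>i\<in>I. a i \<omega>) \<in> M \<rightarrow>\<^sub>M PiM I (\<lambda>_. borel)"
    using ind by (intro measurable_restrict) (auto simp: indep_vars_def)
  have "integrable M (\<lambda>\<omega>. F (\<lambda>i\<in>I. a i \<omega>))"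
  proof (rule integrable_const_bound)
    show "AE \<omega> in M. norm (F (\<lambda>i\<in>I. a i \<omega>))
        \<le> measure (sphere_measure :: (real ^ 'n) measure) (sphere 0 1)"
      by (simp add: F_def abs_defect_le)
    show "(\<lambda>\<omega>. F (\<lambda>i\<in>I. a i \<omega>)) \<in> borel_measurable M"
      by (rule measurable_compose[OF rv F])
  qed
  moreover have "expectation (\<lambda>\<omega>. F (\<lambda>i\<in>I. a i \<omega>)) = 0"
    by (rule expectation_odd_function_symmetric_indep[OF ind symm F odd])
  ultimately show ?thesis
    by (simp only: field flip: I_def)
qed

end
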